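(* Let $X$ be a Banach space, and let $p\in(1,\infty)$ and $\alpha\in(0,1/p)$. (i) If $q\in\big[1,p/(1-p\alpha)\big]$, then $J_{t_0,t}^\alpha:L^p(t_0,t_1;X)\rightarrow L^{q}(t_0,t_1;X)$ is a bounded operator and for every $f\in L^p(t_0,t_1;X)$ it holds that $$\left\|J^\alpha_{t_0,t}f\right\|_{L^q(t_0,t_1;X)}\leq C_{\alpha,p}(t_1-t_0)^{[(p-q)/(pq)]+\alpha}\|f\|_{L^p(t_0,t_1;X)},$$ where $C_{\alpha,p}$ is the constant described in the context. Moreover, for any $\eta\in(p/(1-p\alpha),\infty]$, there exists $f_\eta\in L^p(t_0,t_1;X)$ such that $J_{t_0,t}^\alpha f_\eta(t)$ does not belong to $L^\eta(t_0,t_1;X)$. (ii) If $\eta\in[1,\infty]$ and $\eta\neq p/(1-p\alpha)$, there exists $f_\eta\in L^p(t_0,\infty;X)$ such that $J_{t_0,t}^\alpha f_\eta(t)$ does not belong to $L^\eta(t_0,\infty;X)$.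
   Context: Here $t_0<t_1$ are real numbers. For an interval $I=[t_0,t_1]$ or $I=[t_0,\infty)$ and $r\in[1,\infty]$, $L^r(I;X)$ (written $L^r(t_0,t_1;X)$, resp. $L^r(t_0,\infty;X)$) is the Bochner-Lebesgue space of (classes of) Bochner measurable functions $f:I\to X$ with $\|f\|_X\in L^r(I;\mathbb{R})$, with norm $\big[\int_I\|f(s)\|_X^r\,ds\big]^{1/r}$ if $r<\infty$ and $\operatorname{ess\,sup}_{s\in I}\|f(s)\|_X$ if $r=\infty$. The Riemann-Liouville fractional integral of order $\alpha>0$ at $t_0$ of $f:I\to X$ is $$J_{t_0,t}^\alpha f(t)=\frac{1}{\Gamma(\alpha)}\int_{t_0}^t (t-s)^{\alpha-1}f(s)\,ds,$$ for every $t\in I$ such that the integral exists; $\Gamma$ is Euler's gamma function. The constant $C_{\alpha,p}>0$, which does not depend on the length of $I$, is a constant (such a constant exists) for which $\|J_{t_0,t}^\alpha f\|_{L^{p/(1-p\alpha)}(I;X)}\le C_{\alpha,p}\|f\|_{L^p(I;X)}$ for every $f\in L^p(I;X)$, whether $I=[t_0,t_1]$ or $I=[t_0,\infty)$. *)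

theory Defs
  imports "HOL-Analysis.Analysis" "HOL-Probability.Essential_Supremum"
begin

text \<open>
  Functions on an interval \<open>I\<close> are total functions on \<^typ>\<open>real\<close> of which only the values on \<open>I\<close>
  matter, since everything is stated through \<open>lebesgue_on I\<close>. Elements of the Bochner-Lebesgue
  spaces are represented by functions, with equality almost everywhere as equality of classes.
\<close>

text \<open>
  The value space need not be separable, so Borel measurability would be too weak: Bochner
  measurability is being an almost everywhere limit of step functions (finitely many values,
  measurable support of finite measure).
\<close>

definition bochner_measurable :: "'b measure \<Rightarrow> ('b \<Rightarrow> 'a::real_normed_vector) \<Rightarrow> bool" where
  "bochner_measurable M f \<longleftrightarrow>
     (\<exists>u. (\<forall>n::nat. Bochner_Integration.simple_bochner_integrable M (u n)) \<and>
          (AE x in M. (\<lambda>n. u n x) \<longlonglongrightarrow> f x))"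

text \<open>
  The library's \<^const>\<open>lebesgue_integral\<close> is restricted to second countable value spaces; the
  following is the same construction for arbitrary value spaces, with Borel measurability of \<open>f\<close>
  replaced by almost everywhere convergence of the approximating step functions.
\<close>

definition has_banach_integral ::
  "'b measure \<Rightarrow> ('b \<Rightarrow> 'a::real_normed_vector) \<Rightarrow> 'a \<Rightarrow> bool" where
  "has_banach_integral M f x \<longleftrightarrow>
     (\<exists>u. (\<forall>n::nat. Bochner_Integration.simple_bochner_integrable M (u n)) \<and>
          (AE y in M. (\<lambda>n. u n y) \<longlonglongrightarrow> f y) \<and>
          (\<lambda>n. \<integral>\<^sup>+y. ennreal (norm (f y - u n y)) \<partial>M) \<longlonglongrightarrow> 0 \<and>
          (\<lambda>n. Bochner_Integration.simple_bochner_integral M (u n)) \<longlonglongrightarrow> x)"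

definition banach_integrable :: "'b measure \<Rightarrow> ('b \<Rightarrow> 'a::real_normed_vector) \<Rightarrow> bool" where
  "banach_integrable M f \<longleftrightarrow> (\<exists>x. has_banach_integral M f x)"

definition banach_integral :: "'b measure \<Rightarrow> ('b \<Rightarrow> 'a::real_normed_vector) \<Rightarrow> 'a" where
  "banach_integral M f =
     (if banach_integrable M f then THE x. has_banach_integral M f x else 0)"

definition bochner_Lr :: "real set \<Rightarrow> ereal \<Rightarrow> (real \<Rightarrow> 'a::real_normed_vector) set" where
  "bochner_Lr I r =
     {f. bochner_measurable (lebesgue_on I) f \<and>
         (if r = \<infinity> then esssup (lebesgue_on I) (\<lambda>s. ereal (norm (f s))) < \<infinity>
          else integrable (lebesgue_on I) (\<lambda>s. norm (f s) powr real_of_ereal r))}"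

text \<open>Meaningful only for members of \<^const>\<open>bochner_Lr\<close>.\<close>

definition Lr_norm :: "real set \<Rightarrow> ereal \<Rightarrow> (real \<Rightarrow> 'a::real_normed_vector) \<Rightarrow> real" where
  "Lr_norm I r f =
     (if r = \<infinity> then real_of_ereal (esssup (lebesgue_on I) (\<lambda>s. ereal (norm (f s))))
      else (\<integral>s. norm (f s) powr real_of_ereal r \<partial>lebesgue_on I) powr (1 / real_of_ereal r))"

text \<open>
  The Riemann-Liouville integral is a Bochner integral that may fail to exist for some \<open>t\<close>;
  \<open>RL_integral\<close> is then \<open>0\<close> by convention, so existence is tracked by a separate predicate.
\<close>

definition RL_exists :: "real \<Rightarrow> real \<Rightarrow> (real \<Rightarrow> 'a::real_normed_vector) \<Rightarrow> real \<Rightarrow> bool" where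
  "RL_exists \<alpha> t0 f t \<longleftrightarrow>
     banach_integrable (lebesgue_on {t0..t}) (\<lambda>s. (t - s) powr (\<alpha> - 1) *\<^sub>R f s)"

definition RL_integral ::
  "real \<Rightarrow> real \<Rightarrow> (real \<Rightarrow> 'a::real_normed_vector) \<Rightarrow> real \<Rightarrow> 'a" where
  "RL_integral \<alpha> t0 f t =
     (1 / Gamma \<alpha>) *\<^sub>R banach_integral (lebesgue_on {t0..t}) (\<lambda>s. (t - s) powr (\<alpha> - 1) *\<^sub>R f s)"

text \<open>Bounded linear operators between the spaces of classes, expressed on representatives.\<close>

definition bounded_operator_Lr ::
  "real set \<Rightarrow> ereal \<Rightarrow> ereal \<Rightarrow>
     ((real \<Rightarrow> 'a::real_normed_vector) \<Rightarrow> (real \<Rightarrow> 'a)) \<Rightarrow> bool" where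
  "bounded_operator_Lr I p q T \<longleftrightarrow>
     (\<forall>f \<in> bochner_Lr I p. T f \<in> bochner_Lr I q) \<and>
     (\<forall>f \<in> bochner_Lr I p. \<forall>g \<in> bochner_Lr I p.
        (AE t in lebesgue_on I. f t = g t) \<longrightarrow> (AE t in lebesgue_on I. T f t = T g t)) \<and>
     (\<forall>f \<in> bochner_Lr I p. \<forall>g \<in> bochner_Lr I p.
        AE t in lebesgue_on I. T (\<lambda>s. f s + g s) t = T f t + T g t) \<and>
     (\<forall>c. \<forall>f \<in> bochner_Lr I p. AE t in lebesgue_on I. T (\<lambda>s. c *\<^sub>R f s) t = c *\<^sub>R T f t) \<and>
     (\<exists>K. \<forall>f \<in> bochner_Lr I p. Lr_norm I q (T f) \<le> K * Lr_norm I p f)"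

text \<open>
  \<open>C\<close> is an admissible constant \<open>C\<^bsub>\<alpha>,p\<^esub>\<close> in the Hardy-Littlewood inequality, for functions with
  values in \<^typ>\<open>'a\<close>; it is uniform over all bounded intervals and all half-lines.
\<close>

definition RL_constant :: "'a::real_normed_vector itself \<Rightarrow> real \<Rightarrow> real \<Rightarrow> real \<Rightarrow> bool" where
  "RL_constant X \<alpha> p C \<longleftrightarrow>
     C > 0 \<and>
     (\<forall>a I. (\<exists>b>a. I = {a..b}) \<or> I = {a..} \<longrightarrow>
       (\<forall>f::real \<Rightarrow> 'a. f \<in> bochner_Lr I (ereal p) \<longrightarrow>
          (AE t in lebesgue_on I. RL_exists \<alpha> a f t) \<and>
          RL_integral \<alpha> a f \<in> bochner_Lr I (ereal (p / (1 - p * \<alpha>))) \<and>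
          Lr_norm I (ereal (p / (1 - p * \<alpha>))) (RL_integral \<alpha> a f)
            \<le> C * Lr_norm I (ereal p) f))"

end

theory Submission
  imports Defs
begin

text \<open>
  Part (i) combines the endpoint inequality with Hoelder's inequality on the bounded interval;
  linearity is the uniqueness of the Bochner integral for vector-valued functions. For the
  counterexamples take \<open>f s = (s - t0) powr (-\<beta>) *\<^sub>R x\<close>, cut off to \<open>s - t0 \<in> S\<close>. Estimating the kernel
  from below by \<open>u powr (\<alpha> - 1)\<close> on \<open>[u/2, u]\<close> gives \<open>\<parallel>J f (t0 + u)\<parallel> \<ge> c * u powr (\<alpha> - \<beta>)\<close>.
  With \<open>S = (0, 1]\<close> and \<open>\<alpha> + 1/\<eta> < \<beta> < 1/p\<close> this is too singular at \<open>t0\<close>; with \<open>S = [1, \<infinity>)\<close> and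
  \<open>1/p < \<beta> < min 1 (\<alpha> + 1/\<eta>)\<close> it decays too slowly at infinity. In both cases the contradiction
  comes from the Chebyshev bound on \<open>[t0 + v/2, t0 + v]\<close>, as \<open>v\<close> tends to \<open>0\<close> or to \<open>\<infinity>\<close>.
\<close>

section \<open>Uniqueness and linearity of the Bochner integral\<close>

text \<open>
  Completeness of Lebesgue measure matters here: the additivity of \<open>\<integral>\<^sup>+\<close> needs measurability of
  \<open>norm (f y - u n y)\<close>, where \<open>f\<close> is only an almost everywhere limit of step functions.
\<close>

lemma borel_measurable_lebesgue_on_AE_LIMSEQ:
  fixes u :: "nat \<Rightarrow> real \<Rightarrow> real"
  assumes S: "S \<in> sets lebesgue" and u: "\<And>n. u n \<in> borel_measurable (lebesgue_on S)"
    and lim: "AE x in lebesgue_on S. (\<lambda>n. u n x) \<longlonglongrightarrow> f x"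
  shows "f \<in> borel_measurable (lebesgue_on S)"
proof -
  \<comment> \<open>Extension by zero moves the question to \<open>lebesgue\<close> on the whole
    line; by completeness, a function that agrees almost everywhere with a measurable one is
    measurable there.\<close>
  define v where "v n x = (if x \<in> S then u n x else 0)" for n x
  have v [measurable]: "v n \<in> borel_measurable lebesgue" for n
    using borel_measurable_if[OF S, of "u n"] u unfolding v_def by auto
  have lim': "AE x in lebesgue. x \<in> S \<longrightarrow> (\<lambda>n. u n x) \<longlonglongrightarrow> f x"
    using lim S by (simp add: AE_restrict_space_iff)
  \<comment> \<open>Off \<open>S\<close> the sequence \<open>v\<close> is constantly 0, so
    \<open>lim\<close> is unspecified only at the points of \<open>S\<close> where \<open>u\<close>
    diverges or misses \<open>f\<close>, and these form a null set.\<close>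
  have "AE x in lebesgue. lim (\<lambda>n. v n x) = (if x \<in> S then f x else 0)"
    using lim' by eventually_elim (auto simp: v_def intro: limI)
  moreover have "(\<lambda>x. lim (\<lambda>n. v n x)) \<in> borel_measurable lebesgue"
    by (rule borel_measurable_lim_metric) (rule v)
  ultimately have "(\<lambda>x. if x \<in> S then f x else 0) \<in> borel_measurable lebesgue"
    by (rule borel_measurable_AE[rotated])
  then show ?thesis
    using borel_measurable_if[OF S, of f] by blast
qed

text \<open>The condition \<open>p 0 = 0\<close> keeps the support inside that of \<open>f\<close>,
  hence of finite measure.\<close>

lemma simple_bochner_integrable_compose1:
  assumes "p 0 = 0" "Bochner_Integration.simple_bochner_integrable M f"
  shows "Bochner_Integration.simple_bochner_integrable M (\<lambda>x. p (f x))"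
  using simple_bochner_integrable_compose2[where p="\<lambda>x y. p x" and g=f] assms by blast

text \<open>The triangle inequality through the intermediate point \<open>f x\<close>, integrated.
  Measurability of the two distances is what splits the integral of their sum; \<open>f\<close>
  itself need be neither measurable nor integrable.\<close>

lemma norm_simple_bochner_integral_diff_le:
  fixes u v :: "'b \<Rightarrow> 'a::real_normed_vector"
  assumes u: "Bochner_Integration.simple_bochner_integrable M u"
    and v: "Bochner_Integration.simple_bochner_integrable M v"
    and mu: "(\<lambda>x. norm (f x - u x)) \<in> borel_measurable M"
    and mv: "(\<lambda>x. norm (f x - v x)) \<in> borel_measurable M"
  shows "ennreal (norm (Bochner_Integration.simple_bochner_integral M u
             - Bochner_Integration.simple_bochner_integral M v))
    \<le> (\<integral>\<^sup>+x. ennreal (norm (f x - u x)) \<partial>M) + (\<integral>\<^sup>+x. ennreal (norm (f x - v x)) \<partial>M)"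
proof -
  have "ennreal (norm (Bochner_Integration.simple_bochner_integral M u
             - Bochner_Integration.simple_bochner_integral M v))
     = norm (Bochner_Integration.simple_bochner_integral M (\<lambda>x. u x - v x))"
    using u v by (subst simple_bochner_integral_diff) auto
  also have "\<dots> \<le> Bochner_Integration.simple_bochner_integral M (\<lambda>x. norm (u x - v x))"
    using simple_bochner_integrable_compose2[of "(-)" M u v] u v
    by (auto intro!: simple_bochner_integral_norm_bound)
  also have "\<dots> = (\<integral>\<^sup>+x. norm (u x - v x) \<partial>M)"
    using simple_bochner_integrable_compose2[of "\<lambda>x y. norm (x - y)" M u v] u v
    by (auto intro!: simple_bochner_integral_eq_nn_integral)
  also have "\<dots> \<le> (\<integral>\<^sup>+x. ennreal (norm (f x - u x)) + ennreal (norm (f x - v x)) \<partial>M)"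
  proof (rule nn_integral_mono)
    fix x
    have "norm (u x - v x) \<le> norm (f x - u x) + norm (f x - v x)"
      by (metis dual_order.refl norm_diff_triangle_le norm_minus_commute)
    then show "ennreal (norm (u x - v x)) \<le> ennreal (norm (f x - u x)) + ennreal (norm (f x - v x))"
      by (metis ennreal_leI ennreal_plus norm_ge_zero)
  qed
  also have "\<dots> = (\<integral>\<^sup>+x. ennreal (norm (f x - u x)) \<partial>M) + (\<integral>\<^sup>+x. ennreal (norm (f x - v x)) \<partial>M)"
    using mu mv by (intro nn_integral_add) auto
  finally show ?thesis .
qed

text \<open>The real functions \<open>norm (u n x - v x)\<close> are simple and converge almost
  everywhere to this distance, so only real-valued measurability is involved and no separability of
  \<open>'a\<close>.\<close>

lemma borel_measurable_norm_diff_simple: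
  fixes f :: "real \<Rightarrow> 'a::real_normed_vector"
  assumes S: "S \<in> sets lebesgue"
    and u: "\<And>n. Bochner_Integration.simple_bochner_integrable (lebesgue_on S) (u n)"
    and lim: "AE x in lebesgue_on S. (\<lambda>n. u n x) \<longlonglongrightarrow> f x"
    and v: "Bochner_Integration.simple_bochner_integrable (lebesgue_on S) v"
  shows "(\<lambda>x. norm (f x - v x)) \<in> borel_measurable (lebesgue_on S)"
proof (rule borel_measurable_lebesgue_on_AE_LIMSEQ[OF S])
  show "(\<lambda>x. norm (u n x - v x)) \<in> borel_measurable (lebesgue_on S)" for n
    using simple_bochner_integrable_compose2[of "\<lambda>x y. norm (x - y)" _ "u n" v] u v
    by (auto intro: borel_measurable_simple_function elim: simple_bochner_integrable.cases)
  show "AE x in lebesgue_on S. (\<lambda>n. norm (u n x - v x)) \<longlonglongrightarrow> norm (f x - v x)"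
    using lim by eventually_elim (intro tendsto_intros)
qed

text \<open>Two approximating sequences have simple integrals whose distance is at most the sum of
  their mean errors, which tends to 0. This is what gives the \<open>THE\<close> in
  \<open>banach_integral\<close> its meaning.\<close>

lemma has_banach_integral_unique:
  fixes f :: "real \<Rightarrow> 'a::real_normed_vector"
  assumes S: "S \<in> sets lebesgue"
    and x: "has_banach_integral (lebesgue_on S) f x"
    and y: "has_banach_integral (lebesgue_on S) f y"
  shows "x = y"
proof -
  let ?M = "lebesgue_on S"
  obtain u where u: "\<And>n. Bochner_Integration.simple_bochner_integrable ?M (u n)"
      "AE x in ?M. (\<lambda>n. u n x) \<longlonglongrightarrow> f x"
      "(\<lambda>n. \<integral>\<^sup>+x. ennreal (norm (f x - u n x)) \<partial>?M) \<longlonglongrightarrow> 0"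
      "(\<lambda>n. Bochner_Integration.simple_bochner_integral ?M (u n)) \<longlonglongrightarrow> x"
    using x unfolding has_banach_integral_def by auto
  obtain v where v: "\<And>n. Bochner_Integration.simple_bochner_integrable ?M (v n)"
      "AE x in ?M. (\<lambda>n. v n x) \<longlonglongrightarrow> f x"
      "(\<lambda>n. \<integral>\<^sup>+x. ennreal (norm (f x - v n x)) \<partial>?M) \<longlonglongrightarrow> 0"
      "(\<lambda>n. Bochner_Integration.simple_bochner_integral ?M (v n)) \<longlonglongrightarrow> y"
    using y unfolding has_banach_integral_def by auto
  have 1: "(\<lambda>n. ennreal (norm (Bochner_Integration.simple_bochner_integral ?M (u n)
             - Bochner_Integration.simple_bochner_integral ?M (v n)))) \<longlonglongrightarrow> ennreal (norm (x - y))"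
    by (intro tendsto_intros u v)
  have 2: "(\<lambda>n. (\<integral>\<^sup>+x. ennreal (norm (f x - u n x)) \<partial>?M)
             + (\<integral>\<^sup>+x. ennreal (norm (f x - v n x)) \<partial>?M)) \<longlonglongrightarrow> 0 + 0"
    by (intro tendsto_add u v)
  have 3: "ennreal (norm (Bochner_Integration.simple_bochner_integral ?M (u n)
             - Bochner_Integration.simple_bochner_integral ?M (v n)))
     \<le> (\<integral>\<^sup>+x. ennreal (norm (f x - u n x)) \<partial>?M) + (\<integral>\<^sup>+x. ennreal (norm (f x - v n x)) \<partial>?M)" for n
    by (intro norm_simple_bochner_integral_diff_le u v borel_measurable_norm_diff_simple[OF S u(1,2)])
  have "ennreal (norm (x - y)) \<le> 0 + 0"
    by (rule LIMSEQ_le[OF 1 2]) (use 3 in blast)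
  then show ?thesis
    by simp
qed

lemma banach_integral_eq:
  fixes f :: "real \<Rightarrow> 'a::real_normed_vector"
  assumes "S \<in> sets lebesgue" "has_banach_integral (lebesgue_on S) f x"
  shows "banach_integral (lebesgue_on S) f = x"
  unfolding banach_integral_def banach_integrable_def
  using assms has_banach_integral_unique[OF assms(1)] by (auto intro!: the_equality)

lemma has_banach_integral_cong_AE:
  assumes "AE x in M. f x = g x"
  shows "has_banach_integral M f = has_banach_integral M g"
proof (intro ext)
  fix x
  have "(AE y in M. (\<lambda>n. u n y) \<longlonglongrightarrow> f y) \<longleftrightarrow> (AE y in M. (\<lambda>n. u n y) \<longlonglongrightarrow> g y)"
    for u :: "nat \<Rightarrow> _"
    by (rule eventually_subst) (rule eventually_mono[OF assms], simp)
  moreover have "(\<integral>\<^sup>+y. ennreal (norm (f y - u n y)) \<partial>M) = (\<integral>\<^sup>+y. ennreal (norm (g y - u n y)) \<partial>M)"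
    for u and n :: nat
    by (rule nn_integral_cong_AE) (use assms in eventually_elim, simp)
  ultimately show "has_banach_integral M f x = has_banach_integral M g x"
    unfolding has_banach_integral_def by simp
qed

lemma banach_integral_cong_AE:
  "AE x in M. f x = g x \<Longrightarrow> banach_integral M f = banach_integral M g"
  using has_banach_integral_cong_AE[of f g M]
  by (simp add: banach_integral_def banach_integrable_def)

lemma has_banach_integral_add:
  fixes f g :: "real \<Rightarrow> 'a::real_normed_vector"
  assumes S: "S \<in> sets lebesgue"
    and x: "has_banach_integral (lebesgue_on S) f x"
    and y: "has_banach_integral (lebesgue_on S) g y"
  shows "has_banach_integral (lebesgue_on S) (\<lambda>s. f s + g s) (x + y)"
proof -
  let ?M = "lebesgue_on S"
  obtain u where u: "\<And>n. Bochner_Integration.simple_bochner_integrable ?M (u n)"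
      "AE x in ?M. (\<lambda>n. u n x) \<longlonglongrightarrow> f x"
      "(\<lambda>n. \<integral>\<^sup>+x. ennreal (norm (f x - u n x)) \<partial>?M) \<longlonglongrightarrow> 0"
      "(\<lambda>n. Bochner_Integration.simple_bochner_integral ?M (u n)) \<longlonglongrightarrow> x"
    using x unfolding has_banach_integral_def by auto
  obtain v where v: "\<And>n. Bochner_Integration.simple_bochner_integrable ?M (v n)"
      "AE x in ?M. (\<lambda>n. v n x) \<longlonglongrightarrow> g x"
      "(\<lambda>n. \<integral>\<^sup>+x. ennreal (norm (g x - v n x)) \<partial>?M) \<longlonglongrightarrow> 0"
      "(\<lambda>n. Bochner_Integration.simple_bochner_integral ?M (v n)) \<longlonglongrightarrow> y"
    using y unfolding has_banach_integral_def by auto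
  have le: "(\<integral>\<^sup>+x. ennreal (norm (f x + g x - (u n x + v n x))) \<partial>?M)
      \<le> (\<integral>\<^sup>+x. ennreal (norm (f x - u n x)) \<partial>?M) + (\<integral>\<^sup>+x. ennreal (norm (g x - v n x)) \<partial>?M)" for n
  proof -
    have "(\<integral>\<^sup>+x. ennreal (norm (f x + g x - (u n x + v n x))) \<partial>?M)
      \<le> (\<integral>\<^sup>+x. ennreal (norm (f x - u n x)) + ennreal (norm (g x - v n x)) \<partial>?M)"
    proof (rule nn_integral_mono)
      fix x
      show "ennreal (norm (f x + g x - (u n x + v n x)))
          \<le> ennreal (norm (f x - u n x)) + ennreal (norm (g x - v n x))"
        using norm_diff_triangle_ineq[of "f x" "g x" "u n x" "v n x"]
        by (metis ennreal_leI ennreal_plus norm_ge_zero)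
    qed
    also have "\<dots> = (\<integral>\<^sup>+x. ennreal (norm (f x - u n x)) \<partial>?M) + (\<integral>\<^sup>+x. ennreal (norm (g x - v n x)) \<partial>?M)"
      using borel_measurable_norm_diff_simple[OF S u(1,2) u(1)[of n]]
        borel_measurable_norm_diff_simple[OF S v(1,2) v(1)[of n]]
      by (intro nn_integral_add) auto
    finally show ?thesis .
  qed
  show ?thesis
    unfolding has_banach_integral_def
  proof (intro exI[of _ "\<lambda>n s. u n s + v n s"] conjI allI)
    show "Bochner_Integration.simple_bochner_integrable ?M (\<lambda>s. u n s + v n s)" for n
      by (rule simple_bochner_integrable_compose2[where p="(+)", OF _ u(1) v(1)]) simp
    show "AE s in ?M. (\<lambda>n. u n s + v n s) \<longlonglongrightarrow> f s + g s"
      using u(2) v(2) by eventually_elim (intro tendsto_add)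
    have lim: "(\<lambda>n. (\<integral>\<^sup>+x. ennreal (norm (f x - u n x)) \<partial>?M)
             + (\<integral>\<^sup>+x. ennreal (norm (g x - v n x)) \<partial>?M)) \<longlonglongrightarrow> 0"
      using tendsto_add[OF u(3) v(3)] by simp
    show "(\<lambda>n. \<integral>\<^sup>+x. ennreal (norm (f x + g x - (u n x + v n x))) \<partial>?M) \<longlonglongrightarrow> 0"
      by (rule tendsto_sandwich[OF always_eventually always_eventually tendsto_const lim])
         (use le in \<open>blast intro: zero_le\<close>)+
    show "(\<lambda>n. Bochner_Integration.simple_bochner_integral ?M (\<lambda>s. u n s + v n s)) \<longlonglongrightarrow> x + y"
      using tendsto_add[OF u(4) v(4)] u(1) v(1) by (simp add: simple_bochner_integral_add)
  qed
qed

lemma has_banach_integral_scaleR: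
  fixes f :: "real \<Rightarrow> 'a::real_normed_vector"
  assumes S: "S \<in> sets lebesgue" and x: "has_banach_integral (lebesgue_on S) f x"
  shows "has_banach_integral (lebesgue_on S) (\<lambda>s. c *\<^sub>R f s) (c *\<^sub>R x)"
proof -
  let ?M = "lebesgue_on S"
  obtain u where u: "\<And>n. Bochner_Integration.simple_bochner_integrable ?M (u n)"
      "AE x in ?M. (\<lambda>n. u n x) \<longlonglongrightarrow> f x"
      "(\<lambda>n. \<integral>\<^sup>+x. ennreal (norm (f x - u n x)) \<partial>?M) \<longlonglongrightarrow> 0"
      "(\<lambda>n. Bochner_Integration.simple_bochner_integral ?M (u n)) \<longlonglongrightarrow> x"
    using x unfolding has_banach_integral_def by auto
  show ?thesis
    unfolding has_banach_integral_def
  proof (intro exI[of _ "\<lambda>n s. c *\<^sub>R u n s"] conjI allI)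
    show "Bochner_Integration.simple_bochner_integrable ?M (\<lambda>s. c *\<^sub>R u n s)" for n
      by (rule simple_bochner_integrable_compose1[where p="scaleR c", OF _ u(1)]) simp
    show "AE s in ?M. (\<lambda>n. c *\<^sub>R u n s) \<longlonglongrightarrow> c *\<^sub>R f s"
      using u(2) by eventually_elim (intro tendsto_intros)
    have "(\<integral>\<^sup>+x. ennreal (norm (c *\<^sub>R f x - c *\<^sub>R u n x)) \<partial>?M)
        = ennreal \<bar>c\<bar> * (\<integral>\<^sup>+x. ennreal (norm (f x - u n x)) \<partial>?M)" for n
      using borel_measurable_norm_diff_simple[OF S u(1,2) u(1)[of n]]
      by (subst nn_integral_cmult[symmetric])
         (auto simp flip: scaleR_diff_right ennreal_mult)
    moreover have "(\<lambda>n. ennreal \<bar>c\<bar> * (\<integral>\<^sup>+x. ennreal (norm (f x - u n x)) \<partial>?M)) \<longlonglongrightarrow> ennreal \<bar>c\<bar> * 0"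
      by (rule ennreal_tendsto_cmult[OF _ u(3)]) simp
    ultimately show "(\<lambda>n. \<integral>\<^sup>+x. ennreal (norm (c *\<^sub>R f x - c *\<^sub>R u n x)) \<partial>?M) \<longlonglongrightarrow> 0"
      by simp
    have "Bochner_Integration.simple_bochner_integral ?M (\<lambda>s. c *\<^sub>R u n s)
        = c *\<^sub>R Bochner_Integration.simple_bochner_integral ?M (u n)" for n
      by (rule simple_bochner_integral_linear[OF _ u(1)]) (simp add: linear_scaleR)
    then show "(\<lambda>n. Bochner_Integration.simple_bochner_integral ?M (\<lambda>s. c *\<^sub>R u n s)) \<longlonglongrightarrow> c *\<^sub>R x"
      using tendsto_scaleR[OF tendsto_const u(4)] by simp
  qed
qed

section \<open>Scalar functions times a fixed vector\<close>

text \<open>Bridge from the real integral to the vector-valued one: scalar step functions tending to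
  \<open>g\<close> in mean are multiplied by \<open>x\<close>. It makes the fractional integrals of
  the counterexamples computable.\<close>

lemma has_banach_integral_scaleR_left:
  fixes g :: "'b \<Rightarrow> real" and x :: "'a::real_normed_vector"
  assumes g: "integrable M g"
  shows "has_banach_integral M (\<lambda>s. g s *\<^sub>R x) ((\<integral>s. g s \<partial>M) *\<^sub>R x)"
proof -
  have [measurable]: "g \<in> borel_measurable M" using g by auto
  obtain v where v: "\<And>i. simple_function M (v i)"
      "\<And>s. s \<in> space M \<Longrightarrow> (\<lambda>i. v i s) \<longlonglongrightarrow> g s"
      "\<And>i s. s \<in> space M \<Longrightarrow> norm (v i s) \<le> 2 * norm (g s)"
    using borel_measurable_implies_sequence_metric[of g M 0]
    by (simp add: dist_norm) blast
  have vm [measurable]: "v i \<in> borel_measurable M" for i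
    using v(1) by (rule borel_measurable_simple_function)
  have vi: "integrable M (v i)" for i
    by (rule Bochner_Integration.integrable_bound[of M "\<lambda>s. 2 * norm (g s)"]) (use g v(3) in auto)
  have sb: "Bochner_Integration.simple_bochner_integrable M (v i)" for i
    using vi[of i] v(1) by (intro simple_bochner_integrableI_bounded) (auto simp: integrable_iff_bounded)
  have lim: "(\<lambda>i. \<integral>s. v i s \<partial>M) \<longlonglongrightarrow> (\<integral>s. g s \<partial>M)"
    by (rule integral_dominated_convergence[where w="\<lambda>s. 2 * norm (g s)"]) (use g v in auto)
  have lim0: "(\<lambda>i. \<integral>\<^sup>+s. ennreal (norm (v i s - g s)) \<partial>M) \<longlonglongrightarrow> 0"
  proof -
    have "(\<lambda>i. \<integral>s. norm (v i s - g s) \<partial>M) \<longlonglongrightarrow> (\<integral>s. 0 \<partial>M)"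
    \<comment> \<open>The factor 3 is 2 for \<open>v i\<close>, from its construction, plus 1 for
      \<open>g\<close>.\<close>
    proof (rule integral_dominated_convergence[where w="\<lambda>s. 3 * norm (g s)"])
      show "AE s in M. (\<lambda>i. norm (v i s - g s)) \<longlonglongrightarrow> 0"
        using v(2) by (intro AE_I2 tendsto_norm_zero LIM_zero) auto
      show "AE s in M. norm (norm (v i s - g s)) \<le> 3 * norm (g s)" for i
        using v(3)[of _ i] by (intro AE_I2) (auto intro: order_trans[OF abs_triangle_ineq4])
    qed (use g in auto)
    then have "(\<lambda>i. ennreal (\<integral>s. norm (v i s - g s) \<partial>M)) \<longlonglongrightarrow> ennreal 0"
      by (intro tendsto_ennrealI) simp
    then show ?thesis
      using vi g by (simp add: nn_integral_eq_integral)
  qed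
  show ?thesis
    unfolding has_banach_integral_def
  proof (intro exI[of _ "\<lambda>n s. v n s *\<^sub>R x"] conjI allI)
    show "Bochner_Integration.simple_bochner_integrable M (\<lambda>s. v n s *\<^sub>R x)" for n
      by (rule simple_bochner_integrable_compose1[where p="\<lambda>r. r *\<^sub>R x", OF _ sb]) simp
    show "AE s in M. (\<lambda>n. v n s *\<^sub>R x) \<longlonglongrightarrow> g s *\<^sub>R x"
      using v(2) by (auto intro!: AE_I2 tendsto_intros)
    have "(\<integral>\<^sup>+s. ennreal (norm (g s *\<^sub>R x - v n s *\<^sub>R x)) \<partial>M)
       = ennreal (norm x) * (\<integral>\<^sup>+s. ennreal (norm (v n s - g s)) \<partial>M)" for n
      by (subst nn_integral_cmult[symmetric])
         (auto simp: norm_minus_commute abs_minus_commute mult.commute simp flip: scaleR_diff_left ennreal_mult)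
    moreover have "(\<lambda>n. ennreal (norm x) * (\<integral>\<^sup>+s. ennreal (norm (v n s - g s)) \<partial>M)) \<longlonglongrightarrow> ennreal (norm x) * 0"
      by (rule ennreal_tendsto_cmult[OF _ lim0]) simp
    ultimately show "(\<lambda>n. \<integral>\<^sup>+s. ennreal (norm (g s *\<^sub>R x - v n s *\<^sub>R x)) \<partial>M) \<longlonglongrightarrow> 0"
      by simp
    have "Bochner_Integration.simple_bochner_integral M (\<lambda>s. v n s *\<^sub>R x) = (\<integral>s. v n s \<partial>M) *\<^sub>R x" for n
      using simple_bochner_integral_linear[OF _ sb[of n], of "\<lambda>r. r *\<^sub>R x"] sb[of n]
      by (simp add: simple_bochner_integrable_eq_integral linear_scaleR_left)
    then show "(\<lambda>n. Bochner_Integration.simple_bochner_integral M (\<lambda>s. v n s *\<^sub>R x)) \<longlonglongrightarrow> (\<integral>s. g s \<partial>M) *\<^sub>R x"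
      using tendsto_scaleR[OF lim tendsto_const] by simp
  qed
qed

text \<open>\<open>g\<close> need not be integrable, for instance on a half-line, so the step
  functions approximate the integrable power \<open>g s powr p\<close> and their \<open>p\<close>-th
  roots are taken. The root map vanishes at 0, which preserves supports of finite measure; the
  absolute value is there because the step functions may be negative.\<close>

lemma bochner_measurable_scaleR_left:
  fixes g :: "'b \<Rightarrow> real" and x :: "'a::real_normed_vector"
  assumes g: "integrable M (\<lambda>s. g s powr p)" and p: "0 < p" and nn: "\<And>s. 0 \<le> g s"
  shows "bochner_measurable M (\<lambda>s. g s *\<^sub>R x)"
proof -
  obtain v where v: "\<And>n::nat. Bochner_Integration.simple_bochner_integrable M (v n)"
     "AE s in M. (\<lambda>n. v n s) \<longlonglongrightarrow> g s powr p"
    using has_banach_integral_scaleR_left[OF g, of "1::real"] unfolding has_banach_integral_def by auto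
  show ?thesis
    unfolding bochner_measurable_def
  proof (intro exI[of _ "\<lambda>n s. (\<bar>v n s\<bar> powr (1 / p)) *\<^sub>R x"] conjI allI)
    show "Bochner_Integration.simple_bochner_integrable M (\<lambda>s. (\<bar>v n s\<bar> powr (1 / p)) *\<^sub>R x)" for n
      by (rule simple_bochner_integrable_compose1[where p="\<lambda>r. (\<bar>r\<bar> powr (1 / p)) *\<^sub>R x", OF _ v(1)]) simp
    show "AE s in M. (\<lambda>n. (\<bar>v n s\<bar> powr (1 / p)) *\<^sub>R x) \<longlonglongrightarrow> g s *\<^sub>R x"
      using v(2)
    proof eventually_elim
      case (elim s)
      have "(\<lambda>n. \<bar>v n s\<bar> powr (1 / p)) \<longlonglongrightarrow> \<bar>g s powr p\<bar> powr (1 / p)"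
        using p by (intro tendsto_powr' tendsto_intros elim) auto
      moreover have "\<bar>g s powr p\<bar> powr (1 / p) = g s"
        using p nn[of s] by (simp add: powr_powr)
      ultimately show ?case
        by (intro tendsto_intros) simp
    qed
  qed
qed

section \<open>Inclusion of Lebesgue spaces on a bounded interval\<close>

text \<open>Young's inequality for \<open>y powr r * m powr (1 - r)\<close> and \<open>m\<close>
  with weights \<open>1 / r\<close> and \<open>1 - 1 / r\<close>: the weighted geometric mean is
  \<open>y\<close>. The right side is the tangent of the concave map \<open>z powr (1 / r)\<close>
  at \<open>m powr r\<close>, taken at \<open>z = y powr r\<close>, and \<open>m\<close> stays free
  for later optimisation.\<close>

lemma le_powr_div_add:
  fixes y m r :: real
  assumes "0 \<le> y" "0 < m" "1 \<le> r"
  shows "y \<le> y powr r * (m powr (1 - r) / r) + m * (1 - 1 / r)"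
proof (cases "y = 0")
  case False
  have "(y powr r * m powr (1 - r)) powr (1 / r) * m powr (1 - 1 / r)
      \<le> (1 / r) * (y powr r * m powr (1 - r)) + (1 - 1 / r) * m"
    by (rule Youngs_inequality_0) (use assms False in auto)
  also have "(y powr r * m powr (1 - r)) powr (1 / r) * m powr (1 - 1 / r)
      = y * (m powr ((1 - r) / r) * m powr (1 - 1 / r))"
    using assms by (simp add: powr_mult powr_powr)
  also have "m powr ((1 - r) / r) * m powr (1 - 1 / r) = 1"
    using assms by (simp flip: powr_add add: field_simps)
  finally show ?thesis
    by (simp add: algebra_simps)
qed (use assms in auto)

text \<open>Hoelder's inequality against the constant 1, proved by integrating the pointwise Young
  bound for \<open>g t powr q\<close> with exponent \<open>r = s / q\<close> and then choosing the
  best \<open>m\<close>.\<close>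

lemma integral_powr_le:
  fixes g :: "'b \<Rightarrow> real" and q s :: real
  assumes fin: "finite_measure M" and pos: "0 < measure M (space M)"
    and int: "integrable M (\<lambda>t. g t powr s)" and q: "0 < q" "q \<le> s"
    and meas: "(\<lambda>t. g t powr q) \<in> borel_measurable M" and nn: "\<And>t. 0 \<le> g t"
  shows "integrable M (\<lambda>t. g t powr q)" (is ?A)
    and "(\<integral>t. g t powr q \<partial>M) powr (1 / q)
      \<le> measure M (space M) powr (1 / q - 1 / s) * (\<integral>t. g t powr s \<partial>M) powr (1 / s)" (is ?B)
proof -
  interpret finite_measure M by fact
  define L where "L = measure M (space M)"
  define A where "A = (\<integral>t. g t powr s \<partial>M)"
  define r where "r = s / q"
  have r: "1 \<le> r" using q by (simp add: r_def)
  have pw: "(g t powr q) powr r = g t powr s" for t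
    using q by (simp add: powr_powr r_def)
  have A0: "0 \<le> A" unfolding A_def by (rule Bochner_Integration.integral_nonneg) auto
  have L0: "0 < L" using pos by (simp add: L_def)
  have le: "g t powr q \<le> g t powr s * (m powr (1 - r) / r) + m * (1 - 1 / r)" if "0 < m" for m t
    using le_powr_div_add[of "g t powr q" m r] that r by (simp add: pw)
  show int': ?A
  \<comment> \<open>The Young bound with \<open>m = 1\<close> is an integrable majorant, since
    constants are integrable for a finite measure.\<close>
  proof (rule Bochner_Integration.integrable_bound)
    show "integrable M (\<lambda>t. g t powr s * (1 powr (1 - r) / r) + 1 * (1 - 1 / r))"
      using int by auto
    show "AE t in M. norm (g t powr q) \<le> norm (g t powr s * (1 powr (1 - r) / r) + 1 * (1 - 1 / r))"
      using le[of 1] by (intro AE_I2) (smt (verit) norm_of_real powr_ge_zero real_norm_def)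
  qed fact
  show ?B
  \<comment> \<open>For \<open>A = 0\<close> the optimal \<open>m\<close> would be 0, which the
    Young bound excludes; but then \<open>g\<close> vanishes almost everywhere.\<close>
  proof (cases "A = 0")
    case True
    have "AE t in M. g t powr s = 0"
      using integral_nonneg_eq_0_iff_AE[OF int] True by (auto simp: A_def)
    then have "AE t in M. g t powr q = 0"
      by eventually_elim auto
    then have "(\<integral>t. g t powr q \<partial>M) = 0"
      by (rule integral_eq_zero_AE)
    then show ?thesis by simp
  next
    case False
    with A0 have A1: "0 < A" by simp
    define m where "m = (A / L) powr (1 / r)" \<comment> \<open>minimises the integrated Young bound\<close>
    have m: "0 < m" using A1 L0 by (simp add: m_def)
    have "(\<integral>t. g t powr q \<partial>M) \<le> (\<integral>t. g t powr s * (m powr (1 - r) / r) + m * (1 - 1 / r) \<partial>M)"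
      by (rule integral_mono) (use int int' le[OF m] in auto)
    also have "\<dots> = A * (m powr (1 - r) / r) + L * (m * (1 - 1 / r))"
      using int by (simp add: A_def L_def)
    \<comment> \<open>In terms of \<open>m\<close> the two summands become \<open>L * m / r\<close>
      and \<open>L * m * (1 - 1 / r)\<close>, which add up to \<open>L * m\<close>.\<close>
    also have "A = L * m powr r"
      using A1 L0 r by (simp add: m_def powr_powr)
    also have "L * m powr r * (m powr (1 - r) / r) + L * (m * (1 - 1 / r)) = L * m"
    proof -
      have "m powr r * m powr (1 - r) = m"
        using m by (simp flip: powr_add)
      then have "L * m powr r * (m powr (1 - r) / r) = L * m / r"
        by (metis mult.assoc times_divide_eq_right)
      then show ?thesis by (simp add: algebra_simps)
    qed
    finally have "(\<integral>t. g t powr q \<partial>M) powr (1 / q) \<le> (L * m) powr (1 / q)"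
      using q by (intro powr_mono2 Bochner_Integration.integral_nonneg) auto
    also have "\<dots> = L powr (1 / q) * (A / L) powr (1 / s)"
      using q r A1 L0 by (simp add: m_def powr_mult powr_powr r_def)
    also have "\<dots> = L powr (1 / q - 1 / s) * A powr (1 / s)"
      using A1 L0 by (simp add: powr_divide powr_diff)
    finally show ?thesis by (simp add: L_def A_def)
  qed
qed

lemma borel_measurable_norm_bochner_measurable:
  assumes "bochner_measurable (lebesgue_on S) (f :: real \<Rightarrow> 'a::real_normed_vector)" "S \<in> sets lebesgue"
  shows "(\<lambda>t. norm (f t)) \<in> borel_measurable (lebesgue_on S)"
proof -
  obtain u where u: "\<And>n::nat. Bochner_Integration.simple_bochner_integrable (lebesgue_on S) (u n)"
      "AE x in lebesgue_on S. (\<lambda>n. u n x) \<longlonglongrightarrow> f x"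
    using assms(1) unfolding bochner_measurable_def by auto
  \<comment> \<open>The norm is the distance to the zero step function.\<close>
  have "Bochner_Integration.simple_bochner_integrable (lebesgue_on S) (\<lambda>x. 0::'a)"
    by (simp add: simple_bochner_integrable.simps)
  from borel_measurable_norm_diff_simple[OF assms(2) u this] show ?thesis
    by simp
qed

lemma Lr_norm_le_Lr_norm:
  fixes f :: "real \<Rightarrow> 'a::real_normed_vector" and q s :: real
  assumes f: "f \<in> bochner_Lr {a..b} (ereal s)" and ab: "a < b" and q: "0 < q" "q \<le> s"
  shows "f \<in> bochner_Lr {a..b} (ereal q)"
    and "Lr_norm {a..b} (ereal q) f \<le> (b - a) powr (1 / q - 1 / s) * Lr_norm {a..b} (ereal s) f"
proof -
  let ?M = "lebesgue_on {a..b}"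
  have fin: "finite_measure ?M"
    by (rule finite_measure_lebesgue_on) simp
  have L: "measure ?M (space ?M) = b - a"
    using ab by (simp add: measure_restrict_space)
  have f': "bochner_measurable ?M f" "integrable ?M (\<lambda>t. norm (f t) powr s)"
    using f by (auto simp: bochner_Lr_def)
  have meas: "(\<lambda>t. norm (f t) powr q) \<in> borel_measurable ?M"
    using borel_measurable_norm_bochner_measurable[OF f'(1)] by simp
  have pos: "0 < measure ?M (space ?M)" using L ab by simp
  note * = integral_powr_le[OF fin pos f'(2) q meas norm_ge_zero]
  show "f \<in> bochner_Lr {a..b} (ereal q)"
    using *(1) f'(1) by (simp add: bochner_Lr_def)
  show "Lr_norm {a..b} (ereal q) f \<le> (b - a) powr (1 / q - 1 / s) * Lr_norm {a..b} (ereal s) f"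
    using *(2) unfolding L by (simp add: Lr_norm_def)
qed

section \<open>Fractional integrals of truncated powers\<close>

text \<open>The cutoff set is given in the shifted coordinate \<open>s - a\<close>, so the same
  \<open>S\<close> serves every left endpoint.\<close>

definition truncated_powr :: "real set \<Rightarrow> real \<Rightarrow> real \<Rightarrow> real \<Rightarrow> real" where
  "truncated_powr S a \<beta> s = indicator S (s - a) * (s - a) powr (- \<beta>)"

lemma truncated_powr_nonneg: "0 \<le> truncated_powr S a \<beta> s"
  by (simp add: truncated_powr_def)

lemma borel_measurable_truncated_powr [measurable]:
  "S \<in> sets borel \<Longrightarrow> truncated_powr S a \<beta> \<in> borel_measurable borel"
  unfolding truncated_powr_def
  by (intro borel_measurable_times powr_real_measurable measurable_compose[of "\<lambda>s. s - a" borel borel "indicator S"])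
     auto

lemma integrable_lebesgue_on_if_integrable_lebesgue:
  fixes f :: "real \<Rightarrow> real"
  assumes "integrable lebesgue f" "I \<in> sets lebesgue"
  shows "integrable (lebesgue_on I) f"
proof -
  have "integrable lebesgue (\<lambda>x. if x \<in> I then f x else 0)"
    by (rule Bochner_Integration.integrable_bound[OF assms(1)]) (use assms in auto)
  then show ?thesis
    by (simp add: Lebesgue_Measure.integrable_restrict_UNIV assms)
qed

lemma truncated_powr_in_bochner_Lr:
  fixes x :: "'a::real_normed_vector"
  assumes int: "(\<lambda>u. u powr (- (\<beta> * p))) integrable_on S" and p: "0 < p" and I: "I \<in> sets lebesgue"
  shows "(\<lambda>s. truncated_powr S a \<beta> s *\<^sub>R x) \<in> bochner_Lr I (ereal p)"
proof -
  have "(\<lambda>u. u powr (- (\<beta> * p))) absolutely_integrable_on S"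
    using int by (rule nonnegative_absolutely_integrable_1) simp
  then have "integrable lebesgue (\<lambda>u. indicator S u * u powr (- (\<beta> * p)))"
    by (simp add: set_integrable_def)
  from lebesgue_integrable_real_affine[OF this, of 1 "- a"]
  have "integrable lebesgue (\<lambda>s. indicator S (s - a) * (s - a) powr (- (\<beta> * p)))"
    by simp
  also have "(\<lambda>s. indicator S (s - a) * (s - a) powr (- (\<beta> * p))) = (\<lambda>s. truncated_powr S a \<beta> s powr p)"
    using p by (auto simp: truncated_powr_def powr_powr split: split_indicator)
  finally have *: "integrable (lebesgue_on I) (\<lambda>s. truncated_powr S a \<beta> s powr p)"
    using I by (rule integrable_lebesgue_on_if_integrable_lebesgue)
  then have "integrable (lebesgue_on I) (\<lambda>s. norm (truncated_powr S a \<beta> s *\<^sub>R x) powr p)"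
    by (simp add: powr_mult truncated_powr_nonneg)
  moreover have "bochner_measurable (lebesgue_on I) (\<lambda>s. truncated_powr S a \<beta> s *\<^sub>R x)"
    by (rule bochner_measurable_scaleR_left[OF * p truncated_powr_nonneg])
  ultimately show ?thesis
    by (simp add: bochner_Lr_def)
qed

text \<open>Substituting \<open>s = a + u * x\<close> with \<open>u = t - a\<close> turns the uncut
  product into the integrand of \<open>Beta (1 - \<beta>) \<alpha>\<close>, which converges exactly
  under the conditions on \<open>\<alpha>\<close> and \<open>\<beta>\<close>; the cutoff only makes
  the product smaller.\<close>

lemma integrable_kernel_truncated_powr:
  assumes S: "S \<in> sets borel" "S \<subseteq> {0<..}" and \<alpha>: "0 < \<alpha>" and \<beta>: "\<beta> < 1" and t: "a < t"
  shows "integrable (lebesgue_on {a..t}) (\<lambda>s. (t - s) powr (\<alpha> - 1) * truncated_powr S a \<beta> s)"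
proof -
  define u where "u = t - a"
  have u: "0 < u" using t by (simp add: u_def)
  define F where "F x = indicator {0..1} x * (x powr (- \<beta>) * (1 - x) powr (\<alpha> - 1))" for x :: real
  have "((\<lambda>x. x powr (1 - \<beta> - 1) * (1 - x) powr (\<alpha> - 1)) has_integral Beta (1 - \<beta>) \<alpha>) {0..1}"
    using \<alpha> \<beta> by (intro has_integral_Beta_real) auto
  then have "(\<lambda>x. x powr (- \<beta>) * (1 - x) powr (\<alpha> - 1)) integrable_on {0..1}"
    by (auto simp: integrable_on_def)
  then have "(\<lambda>x. x powr (- \<beta>) * (1 - x) powr (\<alpha> - 1)) absolutely_integrable_on {0..1}"
    by (rule nonnegative_absolutely_integrable_1) simp
  then have "integrable lebesgue F"
    by (simp add: set_integrable_def F_def[abs_def])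
  from lebesgue_integrable_real_affine[OF this, of "1 / u" "- a / u"]
  have "integrable lebesgue (\<lambda>s. F ((s - a) / u))"
    using u by (simp add: diff_divide_distrib)
  \<comment> \<open>The factor \<open>u powr (\<alpha> - 1 - \<beta>)\<close> undoes the scaling of
    the two powers by \<open>1 / u\<close>.\<close>
  then have *: "integrable (lebesgue_on {a..t}) (\<lambda>s. u powr (\<alpha> - 1 - \<beta>) * F ((s - a) / u))"
    by (intro integrable_mult_right integrable_lebesgue_on_if_integrable_lebesgue) auto
  have eq: "u powr (\<alpha> - 1 - \<beta>) * F ((s - a) / u) = (s - a) powr (- \<beta>) * (t - s) powr (\<alpha> - 1)"
    if "s \<in> {a..t}" for s
  proof -
    have "1 - (s - a) / u = (t - s) / u"
      using u by (simp add: field_simps u_def)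
    moreover have "(s - a) / u \<in> {0..1}"
      using that u by (auto simp: u_def)
    ultimately have "F ((s - a) / u) = ((s - a) / u) powr (- \<beta>) * ((t - s) / u) powr (\<alpha> - 1)"
      by (simp add: F_def)
    also have "\<dots> = (s - a) powr (- \<beta>) * (t - s) powr (\<alpha> - 1) * (u powr \<beta> / u powr (\<alpha> - 1))"
      using that u by (simp add: powr_divide powr_minus field_simps)
    finally show ?thesis
      using u by (simp add: powr_diff)
  qed
  show ?thesis
  proof (rule Bochner_Integration.integrable_bound[OF *])
    have "(\<lambda>s. (t - s) powr (\<alpha> - 1) * truncated_powr S a \<beta> s) \<in> borel_measurable borel"
      using S by measurable
    then show "(\<lambda>s. (t - s) powr (\<alpha> - 1) * truncated_powr S a \<beta> s) \<in> borel_measurable (lebesgue_on {a..t})"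
      by (intro measurable_restrict_space1 measurable_completion) simp
    show "AE s in lebesgue_on {a..t}. norm ((t - s) powr (\<alpha> - 1) * truncated_powr S a \<beta> s)
        \<le> norm (u powr (\<alpha> - 1 - \<beta>) * F ((s - a) / u))"
      by (intro AE_I2) (simp add: eq, auto simp: truncated_powr_def split: split_indicator)
  qed
qed

lemma
  fixes x :: "'a::real_normed_vector"
  assumes S: "S \<in> sets borel" "S \<subseteq> {0<..}" and \<alpha>: "0 < \<alpha>" and \<beta>: "\<beta> < 1" and t: "a < t"
  shows RL_exists_truncated_powr: "RL_exists \<alpha> a (\<lambda>s. truncated_powr S a \<beta> s *\<^sub>R x) t"
    and RL_integral_truncated_powr: "RL_integral \<alpha> a (\<lambda>s. truncated_powr S a \<beta> s *\<^sub>R x) t =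
      ((\<integral>s. (t - s) powr (\<alpha> - 1) * truncated_powr S a \<beta> s \<partial>lebesgue_on {a..t}) / Gamma \<alpha>) *\<^sub>R x"
proof -
  have *: "has_banach_integral (lebesgue_on {a..t}) (\<lambda>s. (t - s) powr (\<alpha> - 1) *\<^sub>R truncated_powr S a \<beta> s *\<^sub>R x)
     ((\<integral>s. (t - s) powr (\<alpha> - 1) * truncated_powr S a \<beta> s \<partial>lebesgue_on {a..t}) *\<^sub>R x)"
    using has_banach_integral_scaleR_left[OF integrable_kernel_truncated_powr[OF assms], of x] by simp
  then show "RL_exists \<alpha> a (\<lambda>s. truncated_powr S a \<beta> s *\<^sub>R x) t"
    unfolding RL_exists_def banach_integrable_def by blast
  show "RL_integral \<alpha> a (\<lambda>s. truncated_powr S a \<beta> s *\<^sub>R x) t =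
      ((\<integral>s. (t - s) powr (\<alpha> - 1) * truncated_powr S a \<beta> s \<partial>lebesgue_on {a..t}) / Gamma \<alpha>) *\<^sub>R x"
    unfolding RL_integral_def using banach_integral_eq[OF _ *] by simp
qed

text \<open>On the right half of the interval both bases, \<open>a + u - s\<close> and
  \<open>s - a\<close>, are at most \<open>u\<close> and both exponents are negative, so the
  integrand is at least \<open>u powr (\<alpha> - 1 - \<beta>)\<close>. Integration over length
  \<open>u / 2\<close> gives the rate and the factor 2.\<close>

lemma norm_RL_integral_truncated_powr_ge:
  fixes x :: "'a::real_normed_vector"
  assumes S: "S \<in> sets borel" "S \<subseteq> {0<..}" "{u / 2..u} \<subseteq> S"
    and \<alpha>: "0 < \<alpha>" "\<alpha> < 1" and \<beta>: "0 < \<beta>" "\<beta> < 1" and u: "0 < u"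
  shows "norm x / (2 * Gamma \<alpha>) * u powr (\<alpha> - \<beta>)
    \<le> norm (RL_integral \<alpha> a (\<lambda>s. truncated_powr S a \<beta> s *\<^sub>R x) (a + u))"
proof -
  let ?M = "lebesgue_on {a..a + u}"
  let ?g = "\<lambda>s. (a + u - s) powr (\<alpha> - 1) * truncated_powr S a \<beta> s"
  \<comment> \<open>The right endpoint is left out because there the kernel is
    \<open>0 powr (\<alpha> - 1) = 0\<close>, which violates the lower bound.\<close>
  define J where "J = {a + u / 2..<a + u}"
  have JI: "J \<subseteq> {a..a + u}"
    using u by (auto simp: J_def)
  then have J: "J \<in> sets ?M" "emeasure ?M J = ennreal (u / 2)"
    using u by (auto simp: sets_restrict_space_iff emeasure_restrict_space) (auto simp: J_def)
  have ig: "integrable ?M ?g"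
    using integrable_kernel_truncated_powr[OF S(1,2) \<alpha>(1) \<beta>(2), of a "a + u"] u by simp
  have iJ: "integrable ?M (\<lambda>s. indicator J s * u powr (\<alpha> - 1 - \<beta>))"
    using J by (intro integrable_mult_left integrable_real_indicator) auto
  have "u / 2 * u powr (\<alpha> - 1 - \<beta>) = (\<integral>s. indicator J s * u powr (\<alpha> - 1 - \<beta>) \<partial>?M)"
    using J u JI by (simp add: measure_def Int_absorb2)
  also have "\<dots> \<le> (\<integral>s. ?g s \<partial>?M)"
  proof (rule integral_mono[OF iJ ig])
    fix s
    show "indicator J s * u powr (\<alpha> - 1 - \<beta>) \<le> ?g s"
    proof (cases "s \<in> J")
      case True
      then have s: "s - a \<in> S" "0 < s - a" "s - a \<le> u" "0 < a + u - s" "a + u - s \<le> u"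
        using S(3) u by (auto simp: J_def)
      have "u powr (\<alpha> - 1) * u powr (- \<beta>) \<le> (a + u - s) powr (\<alpha> - 1) * (s - a) powr (- \<beta>)"
        using s \<alpha> \<beta> by (intro mult_mono powr_mono2') auto
      then show ?thesis
        using True s by (simp add: truncated_powr_def flip: powr_add)
    qed (simp add: truncated_powr_nonneg)
  qed
  finally have le: "u / 2 * u powr (\<alpha> - 1 - \<beta>) \<le> (\<integral>s. ?g s \<partial>?M)" .
  have "u * u powr (\<alpha> - 1 - \<beta>) = u powr (\<alpha> - \<beta>)"
    using u by (simp add: powr_mult_base algebra_simps)
  with le have le': "u powr (\<alpha> - \<beta>) / 2 \<le> (\<integral>s. ?g s \<partial>?M)"
    by simp
  have "norm x / (2 * Gamma \<alpha>) * u powr (\<alpha> - \<beta>) = (u powr (\<alpha> - \<beta>) / 2) / Gamma \<alpha> * norm x"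
    by simp
  also have "\<dots> \<le> (\<integral>s. ?g s \<partial>?M) / Gamma \<alpha> * norm x"
    using le' \<alpha> by (intro mult_right_mono divide_right_mono) (auto intro: less_imp_le Gamma_real_pos)
  also have "\<dots> \<le> \<bar>(\<integral>s. ?g s \<partial>?M) / Gamma \<alpha>\<bar> * norm x"
    by (intro mult_right_mono abs_ge_self norm_ge_zero)
  also have "\<dots> = norm (RL_integral \<alpha> a (\<lambda>s. truncated_powr S a \<beta> s *\<^sub>R x) (a + u))"
    using RL_integral_truncated_powr[OF S(1,2) \<alpha>(1) \<beta>(2), of a "a + u" x] u
    by (simp del: abs_divide)
  finally show ?thesis .
qed

section \<open>Lower bounds that exclude membership in \<open>bochner_Lr\<close>\<close>

lemma bochner_Lr_Chebyshev:
  fixes h :: "real \<Rightarrow> 'a::real_normed_vector"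
  assumes h: "h \<in> bochner_Lr I (ereal r)" and r: "0 < r" and I: "I \<in> sets lebesgue"
  obtains K where "\<And>a b m. a < b \<Longrightarrow> {a..b} \<subseteq> I \<Longrightarrow> 0 \<le> m \<Longrightarrow> (\<And>t. t \<in> {a..b} \<Longrightarrow> m \<le> norm (h t)) \<Longrightarrow>
    (b - a) * m powr r \<le> K"
proof
  fix a b m :: real
  assume ab: "a < b" "{a..b} \<subseteq> I" "0 \<le> m" "\<And>t. t \<in> {a..b} \<Longrightarrow> m \<le> norm (h t)"
  have J: "{a..b} \<in> sets (lebesgue_on I)" "emeasure (lebesgue_on I) {a..b} = ennreal (b - a)"
    using ab I by (auto simp: sets_restrict_space_iff emeasure_restrict_space)
  have "(b - a) * m powr r = (\<integral>t. indicator {a..b} t * m powr r \<partial>lebesgue_on I)"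
    using J ab by (simp add: measure_def Int_absorb2)
  also have "\<dots> \<le> (\<integral>t. norm (h t) powr r \<partial>lebesgue_on I)"
  proof (rule integral_mono)
    show "integrable (lebesgue_on I) (\<lambda>t. indicator {a..b} t * m powr r)"
      using J by (intro integrable_mult_left integrable_real_indicator) auto
    show "integrable (lebesgue_on I) (\<lambda>t. norm (h t) powr r)"
      using h by (simp add: bochner_Lr_def)
    show "indicator {a..b} t * m powr r \<le> norm (h t) powr r" for t
      using ab(3) ab(4)[of t] r by (auto simp: indicator_def intro: powr_mono2)
  qed
  \<comment> \<open>Unification fixes \<open>K\<close> here as the integral over all of
    \<open>I\<close>, so one bound serves all subintervals.\<close>
  finally show "(b - a) * m powr r \<le> (\<integral>t. norm (h t) powr r \<partial>lebesgue_on I)" .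
qed

lemma bochner_Linf_bound:
  fixes h :: "real \<Rightarrow> 'a::real_normed_vector"
  assumes h: "h \<in> bochner_Lr I \<infinity>" and I: "I \<in> sets lebesgue"
  obtains K where "\<And>a b m. a < b \<Longrightarrow> {a..b} \<subseteq> I \<Longrightarrow> (\<And>t. t \<in> {a..b} \<Longrightarrow> m \<le> norm (h t)) \<Longrightarrow> m \<le> K"
proof -
  let ?E = "esssup (lebesgue_on I) (\<lambda>s. ereal (norm (h s)))"
  have "?E < \<infinity>" using h by (simp add: bochner_Lr_def)
  \<comment> \<open>Only an upper bound is extracted, since the essential supremum may be minus
    infinity, as on a null set.\<close>
  then obtain K where K: "?E \<le> ereal K"
    by (cases ?E) auto
  have "AE t in lebesgue_on I. ereal (norm (h t)) \<le> ?E"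
    by (rule esssup_AE)
  then have AE: "AE t in lebesgue. t \<in> I \<longrightarrow> norm (h t) \<le> K"
    using K I by (auto simp: AE_restrict_space_iff elim!: eventually_mono dest: order_trans)
  show ?thesis
  proof
    fix a b m :: real
    assume ab: "a < b" "{a..b} \<subseteq> I" "\<And>t. t \<in> {a..b} \<Longrightarrow> m \<le> norm (h t)"
    show "m \<le> K"
    proof (rule ccontr)
      assume "\<not> m \<le> K"
      then have "AE t in lebesgue. t \<notin> {a..b}"
        using ab by (intro eventually_mono[OF AE]) fastforce
      then have "{a..b} \<in> null_sets lebesgue"
        by (subst (asm) AE_iff_null_sets[symmetric]) auto
      then show False
        using ab(1) by (auto simp: null_sets_def)
    qed
  qed
qed

text \<open>The filter \<open>F\<close> lets one argument treat both ends: \<open>at_right 0\<close>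
  for the singularity and \<open>at_top\<close> for slow decay. On a window of length
  \<open>v / 2\<close> the function is at least \<open>c * v powr (\<alpha> - \<beta>)\<close>, so
  membership would bound \<open>v powr (1 + (\<alpha> - \<beta>) * r)\<close>, or
  \<open>v powr (\<alpha> - \<beta>)\<close> in the essentially bounded case.\<close>

lemma RL_integral_truncated_powr_not_in_bochner_Lr:
  fixes x :: "'a::real_normed_vector"
  assumes S: "S \<in> sets borel" "S \<subseteq> {0<..}" and I: "I \<in> sets lebesgue"
    and \<alpha>: "0 < \<alpha>" "\<alpha> < \<beta>" and \<beta>: "\<beta> < 1" and x: "x \<noteq> 0" and F: "F \<noteq> bot"
    and ev: "\<forall>\<^sub>F v in F. 0 < v \<and> {v / 4..v} \<subseteq> S \<and> {a + v / 2..a + v} \<subseteq> I"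
  defines "h \<equiv> RL_integral \<alpha> a (\<lambda>s. truncated_powr S a \<beta> s *\<^sub>R x)"
  shows "0 < r \<Longrightarrow> filterlim (\<lambda>v. v powr (1 + (\<alpha> - \<beta>) * r)) at_top F \<Longrightarrow> h \<notin> bochner_Lr I (ereal r)"
    and "filterlim (\<lambda>v. v powr (\<alpha> - \<beta>)) at_top F \<Longrightarrow> h \<notin> bochner_Lr I \<infinity>"
proof -
  define c where "c = norm x / (2 * Gamma \<alpha>)"
  have c: "0 < c"
    using x \<alpha> by (simp add: c_def Gamma_real_pos)
  \<comment> \<open>With \<open>u = t - a\<close> between \<open>v / 2\<close> and \<open>v\<close>,
    the interval \<open>{u / 2..u}\<close> lies in \<open>{v / 4..v}\<close>; this is where the
    quarter comes from. Since \<open>\<alpha> < \<beta>\<close>, the bound at \<open>u\<close> is at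
    least the one at \<open>v\<close>.\<close>
  have ge: "c * v powr (\<alpha> - \<beta>) \<le> norm (h t)"
    if v: "0 < v" "{v / 4..v} \<subseteq> S" "t \<in> {a + v / 2..a + v}" for v t
  proof -
    define u where "u = t - a"
    have u: "0 < u" "u \<le> v" "{u / 2..u} \<subseteq> S"
      using v by (auto simp: u_def subset_eq)
    have "c * v powr (\<alpha> - \<beta>) \<le> c * u powr (\<alpha> - \<beta>)"
      using c u \<alpha> by (intro mult_left_mono powr_mono2') auto
    also have "\<dots> \<le> norm (h (a + u))"
      unfolding h_def c_def using S u \<alpha> \<beta> by (intro norm_RL_integral_truncated_powr_ge) auto
    finally show ?thesis by (simp add: u_def)
  qed
  {
    assume r: "0 < r" and lim: "filterlim (\<lambda>v. v powr (1 + (\<alpha> - \<beta>) * r)) at_top F"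
    show "h \<notin> bochner_Lr I (ereal r)"
    proof
      assume "h \<in> bochner_Lr I (ereal r)"
      from bochner_Lr_Chebyshev[OF this r I] obtain K
        where K: "\<And>a b m. a < b \<Longrightarrow> {a..b} \<subseteq> I \<Longrightarrow> 0 \<le> m \<Longrightarrow>
          (\<And>t. t \<in> {a..b} \<Longrightarrow> m \<le> norm (h t)) \<Longrightarrow> (b - a) * m powr r \<le> K"
        by blast
      have "filterlim (\<lambda>v. c powr r / 2 * v powr (1 + (\<alpha> - \<beta>) * r)) at_top F"
        using c by (intro filterlim_tendsto_pos_mult_at_top[OF tendsto_const _ lim]) auto
      then have "\<forall>\<^sub>F v in F. K < c powr r / 2 * v powr (1 + (\<alpha> - \<beta>) * r)"
        by (simp add: filterlim_at_top_dense)
      with ev have "\<forall>\<^sub>F v in F. False"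
      proof eventually_elim
        case (elim v)
        have "((a + v) - (a + v / 2)) * (c * v powr (\<alpha> - \<beta>)) powr r \<le> K"
          using elim c by (intro K ge) auto
        also have "((a + v) - (a + v / 2)) * (c * v powr (\<alpha> - \<beta>)) powr r
            = c powr r / 2 * (v * v powr ((\<alpha> - \<beta>) * r))"
          using c by (simp add: powr_mult powr_powr)
        also have "v * v powr ((\<alpha> - \<beta>) * r) = v powr (1 + (\<alpha> - \<beta>) * r)"
          using elim by (simp add: powr_add)
        finally show False using elim by simp
      qed
      with F show False by simp
    qed
  next
    assume lim: "filterlim (\<lambda>v. v powr (\<alpha> - \<beta>)) at_top F"
    show "h \<notin> bochner_Lr I \<infinity>"
    proof
      assume "h \<in> bochner_Lr I \<infinity>"
      from bochner_Linf_bound[OF this I] obtain K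
        where K: "\<And>a b m. a < b \<Longrightarrow> {a..b} \<subseteq> I \<Longrightarrow>
          (\<And>t. t \<in> {a..b} \<Longrightarrow> m \<le> norm (h t)) \<Longrightarrow> m \<le> K"
        by blast
      have "filterlim (\<lambda>v. c * v powr (\<alpha> - \<beta>)) at_top F"
        using c by (intro filterlim_tendsto_pos_mult_at_top[OF tendsto_const _ lim]) auto
      then have "\<forall>\<^sub>F v in F. K < c * v powr (\<alpha> - \<beta>)"
        by (simp add: filterlim_at_top_dense)
      with ev have "\<forall>\<^sub>F v in F. False"
      proof eventually_elim
        case (elim v)
        have "c * v powr (\<alpha> - \<beta>) \<le> K"
          using elim by (intro K[of "a + v / 2" "a + v"] ge) auto
        then show False using elim by simp
      qed
      with F show False by simp
    qed
  }
qed

section \<open>Choice of exponents for the two counterexamples\<close>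

lemma filterlim_neg_powr_at_right_0:
  fixes e :: real
  assumes "e < 0"
  shows "filterlim (\<lambda>v. v powr e) at_top (at_right 0)"
proof -
  have "filterlim (\<lambda>v::real. inverse v powr (- e)) at_top (at_right 0)"
    using assms by (intro filterlim_compose[OF real_powr_at_top filterlim_inverse_at_top_right]) auto
  moreover have "\<forall>\<^sub>F v in at_right 0. inverse v powr (- e) = v powr e"
    using eventually_at_right_less
    by eventually_elim (simp add: powr_def ln_inverse)
  ultimately show ?thesis
    by (simp cong: filterlim_cong)
qed

lemma AE_RL_exists_truncated_powr:
  fixes x :: "'a::real_normed_vector"
  assumes "S \<in> sets borel" "S \<subseteq> {0<..}" "0 < \<alpha>" "\<beta> < 1" "I \<in> sets lebesgue" "I \<subseteq> {a..}"
  shows "AE t in lebesgue_on I. RL_exists \<alpha> a (\<lambda>s. truncated_powr S a \<beta> s *\<^sub>R x) t"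
proof -
  \<comment> \<open>Existence was shown for \<open>a < t\<close> only; the single point
    \<open>a\<close> is discarded as a null set.\<close>
  have "AE t in lebesgue. t \<notin> {a}"
    by (rule AE_not_in) simp
  then have "AE t in lebesgue. t \<in> I \<longrightarrow> RL_exists \<alpha> a (\<lambda>s. truncated_powr S a \<beta> s *\<^sub>R x) t"
  proof eventually_elim
    case (elim t)
    show ?case
    proof
      assume "t \<in> I"
      with elim assms(6) have "a < t" by force
      then show "RL_exists \<alpha> a (\<lambda>s. truncated_powr S a \<beta> s *\<^sub>R x) t"
        using assms by (intro RL_exists_truncated_powr) auto
    qed
  qed
  then show ?thesis
    using assms(5) by (simp add: AE_restrict_space_iff)
qed

text \<open>The obstruction is the singularity at \<open>a\<close>, so \<open>I\<close> need only
  contain some \<open>{a..b}\<close>; this covers the bounded interval and the half-line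
  together.\<close>

lemma ex_RL_integral_not_in_bochner_Lr_large:
  fixes x :: "'a::real_normed_vector" and \<eta> :: ereal
  assumes p: "1 < p" and \<alpha>: "0 < \<alpha>" "\<alpha> < 1 / p" and x: "x \<noteq> 0"
    and I: "I \<in> sets lebesgue" "I \<subseteq> {a..}" "{a..b} \<subseteq> I" "a < b"
    and \<eta>: "ereal (p / (1 - p * \<alpha>)) < \<eta>"
  shows "\<exists>f :: real \<Rightarrow> 'a. f \<in> bochner_Lr I (ereal p) \<and>
    (AE t in lebesgue_on I. RL_exists \<alpha> a f t) \<and> RL_integral \<alpha> a f \<notin> bochner_Lr I \<eta>"
proof -
  let ?S = "{0<..1::real}"
  \<comment> \<open>\<open>w\<close> is the reciprocal of \<open>\<eta>\<close>, with 0 at infinity;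
    being above the critical exponent means \<open>w < 1 / p - \<alpha>\<close>.\<close>
  define w where "w = (if \<eta> = \<infinity> then 0 else 1 / real_of_ereal \<eta>)"
  have pa: "0 < 1 - p * \<alpha>"
    using p \<alpha> by (simp add: field_simps)
  have q0: "0 < p / (1 - p * \<alpha>)"
    using p pa by simp
  have w: "\<alpha> + w < 1 / p"
  proof (cases \<eta>)
    case (real r)
    then have "p / (1 - p * \<alpha>) < r" using \<eta> by simp
    then have "1 / r < 1 / (p / (1 - p * \<alpha>))"
      using q0 by (intro divide_strict_left_mono mult_pos_pos) auto
    also have "\<dots> = 1 / p - \<alpha>"
      using p by (simp add: field_simps)
    finally show ?thesis using real by (simp add: w_def)
  qed (use \<eta> \<alpha> in \<open>auto simp: w_def\<close>)
  \<comment> \<open>The upper bound gives \<open>\<beta> * p < 1\<close>, hence integrability of the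
    \<open>p\<close>-th power at 0. The lower bound makes the exponent of \<open>v\<close> negative,
    so that it blows up at 0.\<close>
  then obtain \<beta> where \<beta>: "\<alpha> + w < \<beta>" "\<beta> < 1 / p"
    using dense by blast
  have w0: "0 \<le> w"
    using \<eta> q0 by (cases \<eta>) (auto simp: w_def)
  have "1 / p < 1" using p by simp
  with \<beta> w0 have \<beta>': "\<alpha> < \<beta>" "\<beta> < 1" by auto
  let ?f = "\<lambda>s. truncated_powr ?S a \<beta> s *\<^sub>R x"
  have "- (\<beta> * p) > - 1"
    using \<beta>(2) p by (simp add: field_simps)
  then have f: "?f \<in> bochner_Lr I (ereal p)"
    using p I by (intro truncated_powr_in_bochner_Lr integrable_on_powr_from_0') auto
  have ex: "AE t in lebesgue_on I. RL_exists \<alpha> a ?f t"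
    using \<alpha> \<beta>' I by (intro AE_RL_exists_truncated_powr) auto
  \<comment> \<open>The 1 keeps \<open>{v / 4..v}\<close> inside the cutoff set, and
    \<open>b - a\<close> keeps the window inside \<open>{a..b}\<close>.\<close>
  have "\<forall>\<^sub>F v in at_right 0. v < min 1 (b - a)"
    using I by (intro order_tendstoD tendsto_intros) auto
  with eventually_at_right_less
  have ev: "\<forall>\<^sub>F v in at_right 0. 0 < v \<and> {v / 4..v} \<subseteq> ?S \<and> {a + v / 2..a + v} \<subseteq> I"
  proof eventually_elim
    case (elim v)
    then have "{a + v / 2..a + v} \<subseteq> {a..b}" by auto
    with elim I show ?case by auto
  qed
  note * = RL_integral_truncated_powr_not_in_bochner_Lr[OF _ _ I(1) \<alpha>(1) \<beta>' x _ ev]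
  have "RL_integral \<alpha> a ?f \<notin> bochner_Lr I \<eta>"
  proof (cases \<eta>)
    case (real r)
    then have r: "0 < r" using \<eta> q0 by auto
    have "1 + (\<alpha> - \<beta>) * r < 0"
      using \<beta>(1) r real by (simp add: w_def field_simps)
    then show ?thesis
      unfolding real using r by (intro *(1) filterlim_neg_powr_at_right_0) auto
  next
    case PInf
    then show ?thesis
      unfolding PInf using \<beta>' by (intro *(2) filterlim_neg_powr_at_right_0) auto
  qed (use \<eta> in auto)
  with f ex show ?thesis by blast
qed

text \<open>The cutoff at 1 removes the singularity, so \<open>\<beta>\<close> may exceed
  \<open>1 / p\<close>: the \<open>p\<close>-th power is then integrable at infinity, while the
  fractional integral decays no faster than a multiple of
  \<open>u powr (\<alpha> - \<beta>)\<close>.\<close>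

lemma ex_RL_integral_not_in_bochner_Lr_small:
  fixes x :: "'a::real_normed_vector" and r :: real
  assumes p: "1 < p" and \<alpha>: "0 < \<alpha>" "\<alpha> < 1 / p" and x: "x \<noteq> 0"
    and r: "0 < r" "r < p / (1 - p * \<alpha>)"
  shows "\<exists>f :: real \<Rightarrow> 'a. f \<in> bochner_Lr {a..} (ereal p) \<and>
    (AE t in lebesgue_on {a..}. RL_exists \<alpha> a f t) \<and> RL_integral \<alpha> a f \<notin> bochner_Lr {a..} (ereal r)"
proof -
  let ?S = "{1::real..}"
  have "1 / (p / (1 - p * \<alpha>)) < 1 / r"
    using r by (intro divide_strict_left_mono mult_pos_pos) auto
  moreover have "1 / (p / (1 - p * \<alpha>)) = 1 / p - \<alpha>"
    using p by (simp add: field_simps)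
  \<comment> \<open>The bound 1 preserves convergence of the kernel integral, and
    \<open>\<alpha> + 1 / r\<close> makes \<open>1 + (\<alpha> - \<beta>) * r\<close>
    positive.\<close>
  ultimately have "1 / p < min 1 (\<alpha> + 1 / r)"
    using p by simp
  then obtain \<beta> where \<beta>: "1 / p < \<beta>" "\<beta> < min 1 (\<alpha> + 1 / r)"
    using dense by blast
  with \<alpha> have \<beta>': "\<alpha> < \<beta>" "\<beta> < 1" by auto
  let ?f = "\<lambda>s. truncated_powr ?S a \<beta> s *\<^sub>R x"
  have "- (\<beta> * p) < - 1"
    using \<beta>(1) p by (simp add: field_simps)
  then have "(\<lambda>u. u powr (- (\<beta> * p))) integrable_on ?S"
    using has_integral_powr_to_inf[of "- (\<beta> * p)" 1] by (auto simp: integrable_on_def)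
  then have f: "?f \<in> bochner_Lr {a..} (ereal p)"
    using p by (intro truncated_powr_in_bochner_Lr) auto
  have ex: "AE t in lebesgue_on {a..}. RL_exists \<alpha> a ?f t"
    using \<alpha> \<beta>' by (intro AE_RL_exists_truncated_powr) auto
  have ev: "\<forall>\<^sub>F v in at_top. 0 < v \<and> {v / 4..v} \<subseteq> ?S \<and> {a + v / 2..a + v} \<subseteq> {a..}"
    using eventually_ge_at_top[of 4] by eventually_elim auto
  have "0 < 1 + (\<alpha> - \<beta>) * r"
    using \<beta>(2) r by (simp add: field_simps)
  then have "RL_integral \<alpha> a ?f \<notin> bochner_Lr {a..} (ereal r)"
    using r \<alpha> \<beta>' x ev
    by (intro RL_integral_truncated_powr_not_in_bochner_Lr(1)[where F=at_top] real_powr_at_top) auto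
  with f ex show ?thesis by blast
qed

section \<open>The operator on a bounded interval\<close>

text \<open>Makes the operator independent of the chosen representative, and does so at every
  \<open>t\<close> with \<open>{a..t}\<close> inside \<open>I\<close>.\<close>

lemma RL_integral_cong_AE:
  assumes "AE t in lebesgue_on I. f t = g t" "{a..t} \<subseteq> I" "I \<in> sets lebesgue"
  shows "RL_integral \<alpha> a f t = RL_integral \<alpha> a g t"
proof -
  have "AE s in lebesgue_on {a..t}. f s = g s"
    using assms(1,2) by (auto simp: AE_restrict_space_iff assms(3) elim!: eventually_mono)
  then show ?thesis
    unfolding RL_integral_def
    by (intro arg_cong2[of _ _ _ _ scaleR] banach_integral_cong_AE refl) (auto elim: eventually_mono)
qed

lemma RL_integral_add:
  fixes f g :: "real \<Rightarrow> 'a::real_normed_vector"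
  assumes "RL_exists \<alpha> a f t" "RL_exists \<alpha> a g t"
  shows "RL_integral \<alpha> a (\<lambda>s. f s + g s) t = RL_integral \<alpha> a f t + RL_integral \<alpha> a g t"
proof -
  obtain y z where
      y: "has_banach_integral (lebesgue_on {a..t}) (\<lambda>s. (t - s) powr (\<alpha> - 1) *\<^sub>R f s) y" and
      z: "has_banach_integral (lebesgue_on {a..t}) (\<lambda>s. (t - s) powr (\<alpha> - 1) *\<^sub>R g s) z"
    using assms by (auto simp: RL_exists_def banach_integrable_def)
  have "has_banach_integral (lebesgue_on {a..t}) (\<lambda>s. (t - s) powr (\<alpha> - 1) *\<^sub>R (f s + g s)) (y + z)"
    using has_banach_integral_add[OF _ y z] by (simp add: scaleR_add_right)
  then show ?thesis
    using y z by (simp add: RL_integral_def banach_integral_eq scaleR_add_right)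
qed

lemma RL_integral_scaleR:
  fixes f :: "real \<Rightarrow> 'a::real_normed_vector"
  assumes "RL_exists \<alpha> a f t"
  shows "RL_integral \<alpha> a (\<lambda>s. c *\<^sub>R f s) t = c *\<^sub>R RL_integral \<alpha> a f t"
proof -
  obtain y where y: "has_banach_integral (lebesgue_on {a..t}) (\<lambda>s. (t - s) powr (\<alpha> - 1) *\<^sub>R f s) y"
    using assms by (auto simp: RL_exists_def banach_integrable_def)
  have "has_banach_integral (lebesgue_on {a..t}) (\<lambda>s. (t - s) powr (\<alpha> - 1) *\<^sub>R c *\<^sub>R f s) (c *\<^sub>R y)"
    using has_banach_integral_scaleR[OF _ y, of c] by (simp add: mult.commute)
  then show ?thesis
    using y by (simp add: RL_integral_def banach_integral_eq mult.commute)
qed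

lemma RL_integral_bounded_operator:
  fixes \<alpha> p C q t0 t1 :: real
  assumes C: "RL_constant TYPE('a::real_normed_vector) \<alpha> p C" and q: "1 \<le> q" "q \<le> p / (1 - p * \<alpha>)"
    and t: "t0 < t1" and p: "1 < p"
  shows "\<And>f::real \<Rightarrow> 'a. f \<in> bochner_Lr {t0..t1} (ereal p) \<Longrightarrow>
      AE t in lebesgue_on {t0..t1}. RL_exists \<alpha> t0 f t"
    and "\<And>f::real \<Rightarrow> 'a. f \<in> bochner_Lr {t0..t1} (ereal p) \<Longrightarrow>
      Lr_norm {t0..t1} (ereal q) (RL_integral \<alpha> t0 f)
        \<le> C * (t1 - t0) powr ((p - q) / (p * q) + \<alpha>) * Lr_norm {t0..t1} (ereal p) f"
    and "bounded_operator_Lr {t0..t1} (ereal p) (ereal q)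
          (RL_integral \<alpha> t0 :: (real \<Rightarrow> 'a) \<Rightarrow> real \<Rightarrow> 'a)"
proof -
  let ?I = "{t0..t1}" and ?s = "p / (1 - p * \<alpha>)"
  have "\<exists>b>t0. ?I = {t0..b}" using t by blast
  then have C': "AE t in lebesgue_on ?I. RL_exists \<alpha> t0 f t"
      "RL_integral \<alpha> t0 f \<in> bochner_Lr ?I (ereal ?s)"
      "Lr_norm ?I (ereal ?s) (RL_integral \<alpha> t0 f) \<le> C * Lr_norm ?I (ereal p) f"
    if "f \<in> bochner_Lr ?I (ereal p)" for f :: "real \<Rightarrow> 'a"
    using C that unfolding RL_constant_def by blast+
  show ex: "AE t in lebesgue_on ?I. RL_exists \<alpha> t0 f t"
    if "f \<in> bochner_Lr ?I (ereal p)" for f :: "real \<Rightarrow> 'a"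
    using C'(1)[OF that] .
  \<comment> \<open>The power of the length lost in the inclusion between the two Lebesgue spaces is
    exactly the exponent in the claimed estimate.\<close>
  have e: "1 / q - 1 / ?s = (p - q) / (p * q) + \<alpha>"
    using p q by (simp add: field_simps)
  show norm: "Lr_norm ?I (ereal q) (RL_integral \<alpha> t0 f)
        \<le> C * (t1 - t0) powr ((p - q) / (p * q) + \<alpha>) * Lr_norm ?I (ereal p) f"
    if f: "f \<in> bochner_Lr ?I (ereal p)" for f :: "real \<Rightarrow> 'a"
  proof -
    have "Lr_norm ?I (ereal q) (RL_integral \<alpha> t0 f)
       \<le> (t1 - t0) powr (1 / q - 1 / ?s) * Lr_norm ?I (ereal ?s) (RL_integral \<alpha> t0 f)"
      using q by (intro Lr_norm_le_Lr_norm(2)[OF C'(2)[OF f] t]) auto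
    also have "\<dots> \<le> (t1 - t0) powr (1 / q - 1 / ?s) * (C * Lr_norm ?I (ereal p) f)"
      by (intro mult_left_mono C'(3)[OF f]) simp
    finally show ?thesis unfolding e by (simp add: mult_ac)
  qed
  show "bounded_operator_Lr ?I (ereal p) (ereal q)
          (RL_integral \<alpha> t0 :: (real \<Rightarrow> 'a) \<Rightarrow> real \<Rightarrow> 'a)"
    unfolding bounded_operator_Lr_def
  proof (intro conjI ballI impI allI exI)
    fix f g :: "real \<Rightarrow> 'a" and c :: real
    assume f: "f \<in> bochner_Lr ?I (ereal p)"
    show "RL_integral \<alpha> t0 f \<in> bochner_Lr ?I (ereal q)"
      using q by (intro Lr_norm_le_Lr_norm(1)[OF C'(2)[OF f] t]) auto
    show "AE t in lebesgue_on ?I. RL_integral \<alpha> t0 (\<lambda>s. c *\<^sub>R f s) t = c *\<^sub>R RL_integral \<alpha> t0 f t"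
      using ex[OF f] by eventually_elim (rule RL_integral_scaleR)
    show "Lr_norm ?I (ereal q) (RL_integral \<alpha> t0 f)
        \<le> (C * (t1 - t0) powr ((p - q) / (p * q) + \<alpha>)) * Lr_norm ?I (ereal p) f"
      by (rule norm[OF f])
    show "AE t in lebesgue_on ?I. RL_integral \<alpha> t0 f t = RL_integral \<alpha> t0 g t"
      if "AE t in lebesgue_on ?I. f t = g t"
      by (rule AE_I2, rule RL_integral_cong_AE[OF that]) auto
    assume g: "g \<in> bochner_Lr ?I (ereal p)"
    show "AE t in lebesgue_on ?I. RL_integral \<alpha> t0 (\<lambda>s. f s + g s) t
        = RL_integral \<alpha> t0 f t + RL_integral \<alpha> t0 g t"
      using ex[OF f] ex[OF g] by eventually_elim (rule RL_integral_add)
  qed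
qed

theorem theorem20:
  fixes t0 t1 p \<alpha> :: real
  assumes "t0 < t1" and "1 < p" and "0 < \<alpha>" and "\<alpha> < 1 / p"
  shows
    "(\<forall>C q. RL_constant TYPE('a::banach) \<alpha> p C \<and> 1 \<le> q \<and> q \<le> p / (1 - p * \<alpha>) \<longrightarrow>
        (\<forall>f::real \<Rightarrow> 'a. f \<in> bochner_Lr {t0..t1} (ereal p) \<longrightarrow>
           (AE t in lebesgue_on {t0..t1}. RL_exists \<alpha> t0 f t)) \<and>
        bounded_operator_Lr {t0..t1} (ereal p) (ereal q)
          (RL_integral \<alpha> t0 :: (real \<Rightarrow> 'a) \<Rightarrow> real \<Rightarrow> 'a) \<and>
        (\<forall>f::real \<Rightarrow> 'a. f \<in> bochner_Lr {t0..t1} (ereal p) \<longrightarrow>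
           Lr_norm {t0..t1} (ereal q) (RL_integral \<alpha> t0 f)
             \<le> C * (t1 - t0) powr ((p - q) / (p * q) + \<alpha>) * Lr_norm {t0..t1} (ereal p) f)) \<and>
     ((\<exists>x::'a. x \<noteq> 0) \<longrightarrow>
        (\<forall>\<eta>::ereal. ereal (p / (1 - p * \<alpha>)) < \<eta> \<longrightarrow>
           (\<exists>f::real \<Rightarrow> 'a. f \<in> bochner_Lr {t0..t1} (ereal p) \<and>
              (AE t in lebesgue_on {t0..t1}. RL_exists \<alpha> t0 f t) \<and>
              RL_integral \<alpha> t0 f \<notin> bochner_Lr {t0..t1} \<eta>))) \<and>
     ((\<exists>x::'a. x \<noteq> 0) \<longrightarrow>
        (\<forall>\<eta>::ereal. 1 \<le> \<eta> \<and> \<eta> \<noteq> ereal (p / (1 - p * \<alpha>)) \<longrightarrow>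
           (\<exists>f::real \<Rightarrow> 'a. f \<in> bochner_Lr {t0..} (ereal p) \<and>
              (AE t in lebesgue_on {t0..}. RL_exists \<alpha> t0 f t) \<and>
              RL_integral \<alpha> t0 f \<notin> bochner_Lr {t0..} \<eta>)))"
  (is "?bound \<and> (_ \<longrightarrow> ?finite) \<and> (_ \<longrightarrow> ?halfline)")
proof (intro conjI impI)
  show ?bound
    using RL_integral_bounded_operator[where 'a='a, OF _ _ _ assms(1,2)] by blast
next
  assume "\<exists>x::'a. x \<noteq> 0"
  then obtain x :: 'a where x: "x \<noteq> 0" by blast
  show ?finite
    using assms by (intro allI impI ex_RL_integral_not_in_bochner_Lr_large[OF _ _ _ x, where b=t1]) auto
next
  assume "\<exists>x::'a. x \<noteq> 0"
  then obtain x :: 'a where x: "x \<noteq> 0" by blast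
  show ?halfline
  proof (intro allI impI)
    fix \<eta> :: ereal
    assume \<eta>: "1 \<le> \<eta> \<and> \<eta> \<noteq> ereal (p / (1 - p * \<alpha>))"
    show "\<exists>f::real \<Rightarrow> 'a. f \<in> bochner_Lr {t0..} (ereal p) \<and>
        (AE t in lebesgue_on {t0..}. RL_exists \<alpha> t0 f t) \<and> RL_integral \<alpha> t0 f \<notin> bochner_Lr {t0..} \<eta>"
    \<comment> \<open>Above the critical exponent the singularity at \<open>t0\<close> already
      suffices. Below it \<open>\<eta>\<close> is a real number, and decay at infinity
      decides.\<close>
    proof (cases "ereal (p / (1 - p * \<alpha>)) < \<eta>")
      case True
      then show ?thesis
        using assms by (intro ex_RL_integral_not_in_bochner_Lr_large[OF _ _ _ x, where b=t1]) auto
    next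
      case False
      with \<eta> obtain r where r: "\<eta> = ereal r" "1 \<le> r" "r < p / (1 - p * \<alpha>)"
        by (cases \<eta>) auto
      then show ?thesis
        using ex_RL_integral_not_in_bochner_Lr_small[OF assms(2-4) x _ r(3)] by simp
    qed
  qed
qed

end
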